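(* Let $\mu_1,\mu_2$ be two LJSDs with $\mu_1\le\mu_2$ and $1\le\zeta_2/\zeta_1\le\eta_2/\eta_1$. Then in the ridgeless limit $\gamma\to0$ and in the overparameterized regime $\psi<\phi$, the generalization gap $E_{\mu_2}-E_{\mu_1}$ is a nonincreasing function of the overparameterization ratio $\phi/\psi$ (where $\phi$, $\mu_1$, $\mu_2$, $\sigma$, $\sigma_\varepsilon^2$ are held fixed and $\psi\in(0,\phi)$ varies).
   Context: Parameters: $\phi>0$, $0<\psi<\phi$, label noise $\sigma_\varepsilon^2\ge0$. Activation $\sigma:\mathbb{R}\to\mathbb{R}$, differentiable almost everywhere with $|\sigma(u)|,|\sigma'(u)|\le c_0e^{c_1|u|}$. LJSD: a limiting joint spectral distribution is a probability measure $\mu$ on $\mathbb{R}_+^2$, the law of a pair $(\lambda,r)$ (training eigenvalue, overlap coefficient of the test covariance), supported in $[0,C]^2$ for some $C$, either absolutely continuous or a finite sum of delta masses; $\mathbb{E}_\mu[\lambda],\mathbb{E}_\mu[r]$ are finite and positive. The marginal of $\lambda$ is $\mu_{\text{train}}$. Order: for LJSDs $\mu_1,\mu_2$ with the same marginal of $\lambda$, $\mu_1\le\mu_2$ means that $\mathbb{E}_{\mu_1}[r|\lambda]/\mathbb{E}_{\mu_2}[r|\lambda]$ is nondecreasing in $\lambda$ on the support of $\mu_{\text{train}}$ and $\mathbb{E}_{\mu_1}[r]\le\mathbb{E}_{\mu_2}[r]$. Constants: for a scale $t>0$ and $z\sim\mathcal N(0,t)$ put $\Omega_\sigma(t)=(\eta,\rho,\zeta,\omega)$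 with $\eta=\mathbb{V}[\sigma(z)]$, $\rho=(\frac1t\mathbb{E}[z\sigma(z)])^2$, $\zeta=t\rho$, $\omega=t(\eta/\zeta-1)$ (assumed well defined). With $s=\mathbb{E}[\lambda]$: $(\eta,\rho,\zeta,\omega)=\Omega_\sigma(s)$. For an LJSD $\mu$ with $s_*=\mathbb{E}_\mu[r]$: $(\eta_*,\rho_*,\zeta_*,\omega_* )=\Omega_\sigma(s_* )$, $\xi=\sqrt{\rho_*/\rho}$. For $\mu_i$: $s_i=\mathbb{E}_{\mu_i}[r]$, $(\eta_i,\rho_i,\zeta_i,\omega_i)=\Omega_\sigma(s_i)$, $\xi_i=\sqrt{\rho_i/\rho}$. Functionals: $\mathcal{I}_{a,b}(x)=\phi\,\mathbb{E}_\mu[\lambda^a(\phi+x\lambda)^{-b}]$, $\mathcal{I}^*_{a,b}(x)=\phi\,\mathbb{E}_\mu[r\lambda^{a-1}(\phi+x\lambda)^{-b}]$. Ridgeless limiting test error for $\psi<\phi$: with $x$ the unique positive real root of $x=1/(\omega+\mathcal{I}_{1,1}(x))$ and functionals evaluated at $x$, $E_\mu=B_\mu+V_\mu$, $B_\mu=(1-\xi)^2s_*+2(1-\xi)\xi\mathcal{I}^*_{1,1}+\xi^2\phi\mathcal{I}^*_{1,2}$, $V_\mu=\xi^2\frac{\psi}{\phi-\psi}x(\sigma_\varepsilon^2+\mathcal{I}_{1,1})(\omega_*+\mathcal{I}^*_{1,1})+\xi^2x\Big(1-\frac{x(\omega-\sigma_\varepsilon^2)}{1-x^2\mathcal{I}_{2,2}}\Big)\mathcal{I}^*_{2,2}$.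 *)

theory Defs
  imports "HOL-Probability.Probability"
begin

section \<open>Activation function and Gaussian constants\<close>

text \<open>The derivative only exists almost everywhere, so its bound is an almost-everywhere bound.\<close>

definition activation :: "(real \<Rightarrow> real) \<Rightarrow> bool" where
  "activation \<sigma> \<longleftrightarrow>
     (AE u in lebesgue. \<sigma> differentiable (at u)) \<and>
     (\<exists>c0 c1. (\<forall>u. \<bar>\<sigma> u\<bar> \<le> c0 * exp (c1 * \<bar>u\<bar>)) \<and>
              (AE u in lebesgue. \<bar>deriv \<sigma> u\<bar> \<le> c0 * exp (c1 * \<bar>u\<bar>)))"

text \<open>
  The centred Gaussian law of variance \<open>t\<close>, as a measure on the Lebesgue (not just the Borel) sets:
  an almost everywhere differentiable function is Lebesgue measurable but need not be Borel
  measurable, and the Bochner integral of a non-measurable function is 0 by convention.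
\<close>

definition gaussian :: "real \<Rightarrow> real measure" where
  "gaussian t = density lebesgue (\<lambda>u. ennreal (normal_density 0 (sqrt t) u))"

definition eta :: "(real \<Rightarrow> real) \<Rightarrow> real \<Rightarrow> real" where
  "eta \<sigma> t = (LINT z|gaussian t. (\<sigma> z - (LINT y|gaussian t. \<sigma> y))\<^sup>2)"

definition rho :: "(real \<Rightarrow> real) \<Rightarrow> real \<Rightarrow> real" where
  "rho \<sigma> t = (1 / t * (LINT z|gaussian t. z * \<sigma> z))\<^sup>2"

definition zeta :: "(real \<Rightarrow> real) \<Rightarrow> real \<Rightarrow> real" where
  "zeta \<sigma> t = t * rho \<sigma> t"

definition omega :: "(real \<Rightarrow> real) \<Rightarrow> real \<Rightarrow> real" where
  "omega \<sigma> t = t * (eta \<sigma> t / zeta \<sigma> t - 1)"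

text \<open>For \<open>t > 0\<close> the only obstruction to the constants being well defined is the division by
  \<open>zeta\<close> (the Gaussian moments exist by the growth bound on the activation).\<close>

definition constants_defined :: "(real \<Rightarrow> real) \<Rightarrow> real \<Rightarrow> bool" where
  "constants_defined \<sigma> t \<longleftrightarrow> zeta \<sigma> t \<noteq> 0"


section \<open>Limiting joint spectral distributions\<close>

definition finite_sum_of_deltas :: "(real \<times> real) measure \<Rightarrow> bool" where
  "finite_sum_of_deltas \<mu> \<longleftrightarrow>
     (\<exists>S w. finite S \<and> (\<forall>p\<in>S. 0 \<le> w p) \<and>
        (\<forall>A\<in>sets borel. measure \<mu> A = (\<Sum>p\<in>S. w p * indicator A p)))"

text \<open>The first coordinate is the eigenvalue \<open>\<lambda>\<close>, the second the overlap coefficient \<open>r\<close>.\<close>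

definition ljsd :: "(real \<times> real) measure \<Rightarrow> bool" where
  "ljsd \<mu> \<longleftrightarrow>
     prob_space \<mu> \<and> sets \<mu> = sets borel \<and>
     (\<exists>C. AE p in \<mu>. p \<in> {0..C} \<times> {0..C}) \<and>
     (absolutely_continuous lborel \<mu> \<or> finite_sum_of_deltas \<mu>) \<and>
     integrable \<mu> fst \<and> 0 < (LINT p|\<mu>. fst p) \<and>
     integrable \<mu> snd \<and> 0 < (LINT p|\<mu>. snd p)"

definition mu_train :: "(real \<times> real) measure \<Rightarrow> real measure" where
  "mu_train \<mu> = distr \<mu> borel fst"

definition mean_lam :: "(real \<times> real) measure \<Rightarrow> real" where
  "mean_lam \<mu> = (LINT p|\<mu>. fst p)"

definition mean_r :: "(real \<times> real) measure \<Rightarrow> real" where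
  "mean_r \<mu> = (LINT p|\<mu>. snd p)"

definition msupport :: "real measure \<Rightarrow> real set" where
  "msupport M = {x. \<forall>U. open U \<longrightarrow> x \<in> U \<longrightarrow> 0 < measure M U}"

text \<open>\<open>cond_mean_r \<mu> g\<close>: the Borel function \<open>g\<close> is a version of \<open>\<lambda> \<mapsto> E\<^sub>\<mu>[r|\<lambda>]\<close>.\<close>

definition cond_mean_r :: "(real \<times> real) measure \<Rightarrow> (real \<Rightarrow> real) \<Rightarrow> bool" where
  "cond_mean_r \<mu> g \<longleftrightarrow>
     g \<in> borel_measurable borel \<and>
     (AE p in \<mu>. real_cond_exp \<mu> (vimage_algebra (space \<mu>) fst borel) snd p = g (fst p))"

text \<open>Conditional expectations are determined only up to null sets, so the monotonicity is that of
  suitable versions; the denominator has to be nonzero for the ratio to make sense.\<close>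

definition ljsd_le :: "(real \<times> real) measure \<Rightarrow> (real \<times> real) measure \<Rightarrow> bool" where
  "ljsd_le \<mu>1 \<mu>2 \<longleftrightarrow>
     mu_train \<mu>1 = mu_train \<mu>2 \<and>
     (\<exists>g1 g2. cond_mean_r \<mu>1 g1 \<and> cond_mean_r \<mu>2 g2 \<and>
        (\<forall>l\<in>msupport (mu_train \<mu>1). g2 l \<noteq> 0) \<and>
        mono_on (msupport (mu_train \<mu>1)) (\<lambda>l. g1 l / g2 l)) \<and>
     mean_r \<mu>1 \<le> mean_r \<mu>2"


section \<open>The ridgeless limiting test error for \<open>\<psi> < \<phi>\<close>\<close>

definition Ifun :: "real \<Rightarrow> (real \<times> real) measure \<Rightarrow> nat \<Rightarrow> nat \<Rightarrow> real \<Rightarrow> real" where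
  "Ifun \<phi> \<mu> a b x = \<phi> * (LINT p|\<mu>. fst p ^ a / (\<phi> + x * fst p) ^ b)"

text \<open>Only used with \<open>a \<ge> 1\<close>, where the subtraction on \<open>nat\<close> does not truncate.\<close>

definition Istar :: "real \<Rightarrow> (real \<times> real) measure \<Rightarrow> nat \<Rightarrow> nat \<Rightarrow> real \<Rightarrow> real" where
  "Istar \<phi> \<mu> a b x = \<phi> * (LINT p|\<mu>. snd p * fst p ^ (a - 1) / (\<phi> + x * fst p) ^ b)"

text \<open>For \<open>\<omega> = 0\<close> (linear activation) a positive root need not exist; without one the formula for
  the error has no meaning, and \<open>xroot\<close> below is an unspecified number.\<close>

definition is_root :: "real \<Rightarrow> (real \<Rightarrow> real) \<Rightarrow> (real \<times> real) measure \<Rightarrow> real \<Rightarrow> bool" where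
  "is_root \<phi> \<sigma> \<mu> x \<longleftrightarrow> 0 < x \<and> x = 1 / (omega \<sigma> (mean_lam \<mu>) + Ifun \<phi> \<mu> 1 1 x)"

definition xroot :: "real \<Rightarrow> (real \<Rightarrow> real) \<Rightarrow> (real \<times> real) measure \<Rightarrow> real" where
  "xroot \<phi> \<sigma> \<mu> = (THE x. is_root \<phi> \<sigma> \<mu> x)"

definition xi :: "(real \<Rightarrow> real) \<Rightarrow> (real \<times> real) measure \<Rightarrow> real" where
  "xi \<sigma> \<mu> = sqrt (rho \<sigma> (mean_r \<mu>) / rho \<sigma> (mean_lam \<mu>))"

definition bias :: "real \<Rightarrow> (real \<Rightarrow> real) \<Rightarrow> (real \<times> real) measure \<Rightarrow> real" where
  "bias \<phi> \<sigma> \<mu> =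
     (let x = xroot \<phi> \<sigma> \<mu>; \<xi> = xi \<sigma> \<mu>
      in (1 - \<xi>)\<^sup>2 * mean_r \<mu> + 2 * (1 - \<xi>) * \<xi> * Istar \<phi> \<mu> 1 1 x
         + \<xi>\<^sup>2 * \<phi> * Istar \<phi> \<mu> 1 2 x)"

text \<open>\<open>v\<close> is the label noise variance \<open>\<sigma>\<^sub>\<epsilon>\<^sup>2\<close>.\<close>

definition variance_term ::
  "real \<Rightarrow> real \<Rightarrow> real \<Rightarrow> (real \<Rightarrow> real) \<Rightarrow> (real \<times> real) measure \<Rightarrow> real" where
  "variance_term \<phi> \<psi> v \<sigma> \<mu> =
     (let x = xroot \<phi> \<sigma> \<mu>; \<xi> = xi \<sigma> \<mu>;
          \<omega> = omega \<sigma> (mean_lam \<mu>); \<omega>s = omega \<sigma> (mean_r \<mu>)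
      in \<xi>\<^sup>2 * (\<psi> / (\<phi> - \<psi>)) * x * (v + Ifun \<phi> \<mu> 1 1 x) * (\<omega>s + Istar \<phi> \<mu> 1 1 x)
         + \<xi>\<^sup>2 * x * (1 - x * (\<omega> - v) / (1 - x\<^sup>2 * Ifun \<phi> \<mu> 2 2 x)) * Istar \<phi> \<mu> 2 2 x)"

definition test_error ::
  "real \<Rightarrow> real \<Rightarrow> real \<Rightarrow> (real \<Rightarrow> real) \<Rightarrow> (real \<times> real) measure \<Rightarrow> real" where
  "test_error \<phi> \<psi> v \<sigma> \<mu> = bias \<phi> \<sigma> \<mu> + variance_term \<phi> \<psi> v \<sigma> \<mu>"

end

theory Submission
  imports Defs
begin

text \<open>
  The root \<open>x\<close> and the functionals \<open>I\<^sub>a\<^sub>b\<close> depend on \<open>\<mu>\<close> only through the law of \<open>\<lambda>\<close>, so they agree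
  for \<open>\<mu>1\<close> and \<open>\<mu>2\<close>, and \<open>\<psi>\<close> enters the gap only as
  \<open>\<psi> / (\<phi> - \<psi>) * x * (v + I\<^sub>1\<^sub>1) * (A\<^sub>2 - A\<^sub>1)\<close>. Here \<open>\<rho> * A\<^sub>i = \<eta>\<^sub>i - \<zeta>\<^sub>i * (1 - q\<^sub>i)\<close>, where \<open>q\<^sub>i\<close> is the
  average of \<open>\<phi> / (\<phi> + x * \<lambda>)\<close> under \<open>\<mu>\<^sub>i\<close> weighted by \<open>r\<close>. As the ratio of the conditional means of
  \<open>r\<close> is nondecreasing in \<open>\<lambda>\<close>, the weighting by \<open>\<mu>2\<close> favours small \<open>\<lambda>\<close>, so \<open>q\<^sub>1 \<le> q\<^sub>2\<close>; together with
  \<open>\<zeta>\<^sub>1 \<le> \<eta>\<^sub>1\<close> (Cauchy-Schwarz) and \<open>1 \<le> \<zeta>\<^sub>2 / \<zeta>\<^sub>1 \<le> \<eta>\<^sub>2 / \<eta>\<^sub>1\<close> this gives \<open>A\<^sub>1 \<le> A\<^sub>2\<close>. Cauchy-Schwarz also gives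
  \<open>\<omega> \<ge> 0\<close>, hence uniqueness of the root \<open>x\<close> and its positivity.
\<close>

section \<open>Gaussian moments and the inequality between zeta and eta\<close>

text \<open>Completion does not change integrals of Borel functions, so the moment facts about
  normal densities on \<open>lborel\<close> carry over to \<open>gaussian\<close>.\<close>

lemma gaussian_borel:
  fixes f :: "real \<Rightarrow> real"
  assumes [measurable]: "f \<in> borel_measurable borel"
  shows integrable_gaussian_iff:
      "integrable (gaussian t) f \<longleftrightarrow> integrable lborel (\<lambda>z. normal_density 0 (sqrt t) z * f z)"
    and integral_gaussian:
      "(LINT z|gaussian t. f z) = (LINT z|lborel. normal_density 0 (sqrt t) z * f z)"
proof -
  have [measurable]: "f \<in> borel_measurable lebesgue"
    "normal_density 0 (sqrt t) \<in> borel_measurable lebesgue"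
    by (simp_all add: measurable_completion)
  show "integrable (gaussian t) f \<longleftrightarrow> integrable lborel (\<lambda>z. normal_density 0 (sqrt t) z * f z)"
    unfolding gaussian_def by (subst integrable_density) (auto simp: integrable_completion)
  show "(LINT z|gaussian t. f z) = (LINT z|lborel. normal_density 0 (sqrt t) z * f z)"
    unfolding gaussian_def by (subst integral_density) (auto simp: integral_completion)
qed

lemma
  assumes "0 < t"
  shows integrable_gaussian_power: "integrable (gaussian t) (\<lambda>z. z ^ k)"
    and integral_gaussian_id: "(LINT z|gaussian t. z) = 0"
    and integral_gaussian_square: "(LINT z|gaussian t. z\<^sup>2) = t"
  using assms integrable_normal_moment[of "sqrt t" 0 k] integral_normal_moment_odd[of "sqrt t" 0 0]
    integral_normal_moment_even[of "sqrt t" 0 1]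
  by (simp_all add: integrable_gaussian_iff integral_gaussian fact_numeral)

lemma prob_space_gaussian:
  assumes "0 < t"
  shows "prob_space (gaussian t)"
proof
  have "emeasure (gaussian t) (space (gaussian t)) = (\<integral>\<^sup>+ z. normal_density 0 (sqrt t) z \<partial>lborel)"
    by (simp add: gaussian_def emeasure_density measurable_completion nn_integral_completion)
  also have "\<dots> = 1"
    using assms by (simp add: nn_integral_eq_integral)
  finally show "emeasure (gaussian t) (space (gaussian t)) = 1" .
qed

text \<open>Completing the square: an exponential tilt moves the mean of a normal density and
  rescales it. Hence all exponential moments are finite.\<close>

lemma normal_density_mult_exp:
  assumes "0 < s"
  shows "normal_density 0 s u * exp (a * u) = exp (a\<^sup>2 * s\<^sup>2 / 2) * normal_density (a * s\<^sup>2) s u"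
proof -
  have "- (u\<^sup>2) / (2 * s\<^sup>2) + a * u = a\<^sup>2 * s\<^sup>2 / 2 + - ((u - a * s\<^sup>2)\<^sup>2) / (2 * s\<^sup>2)"
    using assms by (simp add: field_simps power2_eq_square)
  then have "exp (- (u\<^sup>2) / (2 * s\<^sup>2)) * exp (a * u)
      = exp (a\<^sup>2 * s\<^sup>2 / 2) * exp (- ((u - a * s\<^sup>2)\<^sup>2) / (2 * s\<^sup>2))"
    by (metis exp_add)
  then show ?thesis
    by (simp add: normal_density_def)
qed

lemma integrable_gaussian_exp:
  assumes "0 < t"
  shows "integrable (gaussian t) (\<lambda>z. exp (a * z))"
  using assms by (simp add: integrable_gaussian_iff normal_density_mult_exp)

text \<open>The squared growth bound is exponential in the absolute value of \<open>u\<close>, hence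
  dominated by a sum of two integrable exponentials.\<close>

lemma integrable_gaussian_activation_square:
  assumes "activation \<sigma>" "0 < t" and [measurable]: "\<sigma> \<in> borel_measurable lebesgue"
  shows "integrable (gaussian t) (\<lambda>z. (\<sigma> z)\<^sup>2)"
proof -
  obtain c0 c1 where c: "\<And>u. \<bar>\<sigma> u\<bar> \<le> c0 * exp (c1 * \<bar>u\<bar>)"
    using assms(1) unfolding activation_def by blast
  have bound: "(\<sigma> u)\<^sup>2 \<le> c0\<^sup>2 * (exp (2 * c1 * u) + exp (- 2 * c1 * u))" for u
  proof -
    have "(\<sigma> u)\<^sup>2 \<le> (c0 * exp (c1 * \<bar>u\<bar>))\<^sup>2"
      using c[of u] by (metis abs_ge_zero power2_abs power_mono)
    also have "\<dots> = c0\<^sup>2 * exp (2 * c1 * \<bar>u\<bar>)"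
      by (simp add: power_mult_distrib mult.assoc flip: exp_double)
    also have "\<dots> \<le> c0\<^sup>2 * (exp (2 * c1 * u) + exp (- 2 * c1 * u))"
      by (intro mult_left_mono) (auto simp: abs_if)
    finally show ?thesis .
  qed
  show ?thesis
  proof (rule Bochner_Integration.integrable_bound)
    show "integrable (gaussian t) (\<lambda>u. c0\<^sup>2 * (exp (2 * c1 * u) + exp (- 2 * c1 * u)))"
      using assms(2)
      by (intro integrable_mult_right Bochner_Integration.integrable_add integrable_gaussian_exp)
    show "(\<lambda>z. (\<sigma> z)\<^sup>2) \<in> borel_measurable (gaussian t)"
      unfolding gaussian_def by measurable
    show "AE u in gaussian t. norm ((\<sigma> u)\<^sup>2)
        \<le> norm (c0\<^sup>2 * (exp (2 * c1 * u) + exp (- 2 * c1 * u)))"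
      using bound by (intro AE_I2) (auto intro: order_trans)
  qed
qed

text \<open>The measurability of \<open>\<sigma>\<close> need not be derived from its almost everywhere differentiability:
  if \<open>\<sigma>\<close> were not measurable, the integral defining \<open>zeta\<close> would be the junk value 0.\<close>

lemma zeta_le_eta:
  assumes "activation \<sigma>" "0 < t" "zeta \<sigma> t \<noteq> 0"
  shows "0 < zeta \<sigma> t" "zeta \<sigma> t \<le> eta \<sigma> t"
proof -
  interpret G: prob_space "gaussian t"
    using assms(2) by (rule prob_space_gaussian)
  have sets_G: "sets (gaussian t) = sets lebesgue"
    by (simp add: gaussian_def)
  define J where "J = (LINT z|gaussian t. z * \<sigma> z)"
  define m where "m = (LINT z|gaussian t. \<sigma> z)"
  have zeta: "zeta \<sigma> t = J\<^sup>2 / t"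
    using assms(2) by (simp add: zeta_def rho_def J_def power2_eq_square)
  then have "J \<noteq> 0"
    using assms(3) by auto
  then show "0 < zeta \<sigma> t"
    using assms(2) zeta by simp
  have int_z\<sigma>: "integrable (gaussian t) (\<lambda>z. z * \<sigma> z)"
    using \<open>J \<noteq> 0\<close> not_integrable_integral_eq unfolding J_def by blast
  then have [measurable]: "(\<lambda>z. z * \<sigma> z) \<in> borel_measurable lebesgue"
    using sets_G by (metis borel_measurable_integrable measurable_cong_sets)
  have meas_id: "(\<lambda>z. z) \<in> borel_measurable lebesgue"
    by (simp add: measurable_completion)
  then have [measurable]: "Measurable.pred lebesgue (\<lambda>z :: real. z = 0)"
    by measurable
  \<comment> \<open>Dividing the measurable product by \<open>z\<close> recovers
    \<open>\<sigma>\<close>; only the value at 0 is lost, and it is put back by hand.\<close>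
  have "(\<lambda>z. if z = 0 then \<sigma> 0 else z * \<sigma> z / z) \<in> borel_measurable lebesgue"
    using meas_id by measurable
  also have "(\<lambda>z. if z = 0 then \<sigma> 0 else z * \<sigma> z / z) = \<sigma>"
    by auto
  finally have meas: "\<sigma> \<in> borel_measurable lebesgue" .
  then have int_sq: "integrable (gaussian t) (\<lambda>z. (\<sigma> z)\<^sup>2)"
    using assms by (intro integrable_gaussian_activation_square)
  have "\<sigma> \<in> borel_measurable (gaussian t)"
    using meas sets_G by (metis measurable_cong_sets)
  then have int_\<sigma>: "integrable (gaussian t) \<sigma>"
    using int_sq by (rule G.square_integrable_imp_integrable)
  have int_z: "integrable (gaussian t) (\<lambda>z. z)" "integrable (gaussian t) (\<lambda>z. z\<^sup>2)"
    using integrable_gaussian_power[OF assms(2), of 1] integrable_gaussian_power[OF assms(2), of 2]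
    by simp_all
  have int_dev: "integrable (gaussian t) (\<lambda>z. (\<sigma> z - m)\<^sup>2)"
    using int_sq int_\<sigma> by (simp add: power2_diff)
  \<comment> \<open>The least-squares slope of \<open>\<sigma> z - m\<close> on \<open>z\<close>: it
    minimises the quadratic in \<open>c\<close> obtained below, and the minimum is
    \<open>eta - J^2 / t\<close>.\<close>
  define c where "c = J / t"
  have "0 \<le> (LINT z|gaussian t. (\<sigma> z - m - c * z)\<^sup>2)"
    by simp
  also have "\<dots> = (LINT z|gaussian t. (\<sigma> z - m)\<^sup>2 - 2 * c * (z * \<sigma> z) + 2 * c * m * z + c\<^sup>2 * z\<^sup>2)"
    by (intro Bochner_Integration.integral_cong refl) (simp add: power2_eq_square algebra_simps)
  also have "\<dots> = eta \<sigma> t - 2 * c * J + c\<^sup>2 * t"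
    using int_dev int_z\<sigma> int_z assms(2)
    by (simp add: eta_def J_def flip: m_def)
       (simp add: integral_gaussian_id integral_gaussian_square)
  also have "\<dots> = eta \<sigma> t - zeta \<sigma> t"
    using assms(2) by (simp add: zeta c_def field_simps power2_eq_square)
  finally show "zeta \<sigma> t \<le> eta \<sigma> t"
    by simp
qed

section \<open>Supports, conditional means and the likelihood ratio inequality\<close>

text \<open>The complement of the support is covered by the null members of a countable basis. This
  matters because the order controls the ratio of conditional means on the support only.\<close>

lemma AE_msupport:
  assumes "finite_measure M" and sets_M: "sets M = sets borel"
  shows "AE x in M. x \<in> msupport M"
proof -
  interpret finite_measure M by fact
  obtain B :: "real set set" where B: "countable B" "topological_basis B"
    using ex_countable_basis by blast
  have "AE x in M. \<forall>b\<in>{b\<in>B. measure M b = 0}. x \<notin> b"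
  proof (subst AE_ball_countable)
    show "countable {b \<in> B. measure M b = 0}"
      using B(1) by (rule countable_subset[rotated]) auto
    show "\<forall>b\<in>{b \<in> B. measure M b = 0}. AE x in M. x \<notin> b"
    proof safe
      fix b assume "b \<in> B" "measure M b = 0"
      then have "b \<in> null_sets M"
        using topological_basis_open[OF B(2)] by (auto simp: null_sets_def emeasure_eq_measure sets_M)
      then show "AE x in M. x \<notin> b"
        by (rule AE_not_in)
    qed
  qed
  then show ?thesis
  proof (rule AE_mp, intro AE_I2 impI)
    fix x assume x: "\<forall>b\<in>{b\<in>B. measure M b = 0}. x \<notin> b"
    show "x \<in> msupport M"
      unfolding msupport_def
    proof safe
      fix U :: "real set" assume U: "open U" "x \<in> U"
      then obtain b where b: "b \<in> B" "x \<in> b" "b \<subseteq> U"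
        using topological_basisE[OF B(2)] by metis
      with x have "0 < measure M b"
        using measure_nonneg[of M b] by (auto simp: less_le)
      also have "\<dots> \<le> measure M U"
        using b U sets_M by (intro finite_measure_mono) auto
      finally show "0 < measure M U" .
    qed
  qed
qed

lemma ljsdE:
  assumes "ljsd \<mu>"
  obtains C where "0 \<le> C" "AE p in \<mu>. fst p \<in> {0..C} \<and> snd p \<in> {0..C}"
proof -
  obtain C where "AE p in \<mu>. p \<in> {0..C} \<times> {0..C}"
    using assms unfolding ljsd_def by blast
  then have "AE p in \<mu>. fst p \<in> {0..\<bar>C\<bar>} \<and> snd p \<in> {0..\<bar>C\<bar>}"
    by (rule AE_mp) (auto intro!: AE_I2)
  then show ?thesis
    using that[of "\<bar>C\<bar>"] by simp
qed

lemma ljsd_measurable: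
  assumes "ljsd \<mu>"
  shows "borel_measurable \<mu> = borel_measurable borel" "fst \<in> borel_measurable \<mu>"
    "snd \<in> borel_measurable \<mu>"
proof -
  show "borel_measurable \<mu> = borel_measurable borel"
    using assms by (intro measurable_cong_sets) (auto simp: ljsd_def)
  then show "fst \<in> borel_measurable \<mu>" "snd \<in> borel_measurable \<mu>"
    by (auto intro!: borel_measurable_continuous_onI continuous_on_fst continuous_on_snd)
qed

lemma integral_mu_train:
  fixes h :: "real \<Rightarrow> real"
  assumes "ljsd \<mu>" "h \<in> borel_measurable borel"
  shows "integrable (mu_train \<mu>) h \<longleftrightarrow> integrable \<mu> (\<lambda>p. h (fst p))"
    and "(LINT l|mu_train \<mu>. h l) = (LINT p|\<mu>. h (fst p))"
  unfolding mu_train_def using assms ljsd_measurable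
  by (auto simp: integrable_distr_eq integral_distr)

text \<open>The averaging property of conditional expectation, pushed forward to the law of the
  eigenvalue. Integrals under \<open>\<mu>1\<close> and \<open>\<mu>2\<close> thereby become
  integrals over one common measure, where \<open>g1\<close> and \<open>g2\<close> can be
  compared.\<close>

lemma cond_mean_r_integral:
  assumes \<mu>: "ljsd \<mu>" and g: "cond_mean_r \<mu> g" and [measurable]: "h \<in> borel_measurable borel"
    and int: "integrable \<mu> (\<lambda>p. h (fst p) * snd p)"
  shows "integrable (mu_train \<mu>) (\<lambda>l. h l * g l)"
    and "(LINT l|mu_train \<mu>. h l * g l) = (LINT p|\<mu>. h (fst p) * snd p)"
proof -
  let ?F = "vimage_algebra (space \<mu>) fst (borel :: real measure)"
  interpret prob_space \<mu> using \<mu> by (simp add: ljsd_def)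
  note [measurable] = ljsd_measurable[OF \<mu>]
  have [measurable]: "g \<in> borel_measurable borel"
    using g by (simp add: cond_mean_r_def)
  interpret finite_measure_subalgebra \<mu> ?F
    by standard (simp add: subalgebra_def sets_image_in_sets ljsd_measurable(2)[OF \<mu>])
  have "(\<lambda>p. h (fst p)) \<in> borel_measurable ?F"
    by (rule measurable_compose[OF measurable_vimage_algebra1]) auto
  note intg = real_cond_exp_intg[OF int this ljsd_measurable(3)[OF \<mu>]]
  have ae: "AE p in \<mu>. h (fst p) * real_cond_exp \<mu> ?F snd p = h (fst p) * g (fst p)"
    using g by (auto simp: cond_mean_r_def)
  have cong: "integrable \<mu> (\<lambda>p. h (fst p) * real_cond_exp \<mu> ?F snd p)
      \<longleftrightarrow> integrable \<mu> (\<lambda>p. h (fst p) * g (fst p))"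
    using ae by (intro integrable_cong_AE) auto
  have cong': "(LINT p|\<mu>. h (fst p) * real_cond_exp \<mu> ?F snd p) = (LINT p|\<mu>. h (fst p) * g (fst p))"
    using ae by (intro integral_cong_AE) auto
  show "integrable (mu_train \<mu>) (\<lambda>l. h l * g l)"
    using intg(1) cong by (subst integral_mu_train[OF \<mu>]) auto
  show "(LINT l|mu_train \<mu>. h l * g l) = (LINT p|\<mu>. h (fst p) * snd p)"
    using intg(2) cong' by (subst integral_mu_train[OF \<mu>]) auto
qed

text \<open>Together with the nonvanishing on the support demanded by \<open>ljsd_le\<close>, this
  makes the denominator positive almost everywhere.\<close>

lemma cond_mean_r_nonneg:
  assumes \<mu>: "ljsd \<mu>" and g: "cond_mean_r \<mu> g"
  shows "AE l in mu_train \<mu>. 0 \<le> g l"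
proof -
  let ?F = "vimage_algebra (space \<mu>) fst (borel :: real measure)"
  interpret prob_space \<mu> using \<mu> by (simp add: ljsd_def)
  note [measurable] = ljsd_measurable[OF \<mu>]
  have [measurable]: "g \<in> borel_measurable borel"
    using g by (simp add: cond_mean_r_def)
  interpret finite_measure_subalgebra \<mu> ?F
    by standard (simp add: subalgebra_def sets_image_in_sets ljsd_measurable(2)[OF \<mu>])
  obtain C where "AE p in \<mu>. fst p \<in> {0..C} \<and> snd p \<in> {0..C}"
    using ljsdE[OF \<mu>] by blast
  then have "AE p in \<mu>. 0 \<le> real_cond_exp \<mu> ?F snd p"
    by (intro real_cond_exp_pos) auto
  then have "AE p in \<mu>. 0 \<le> g (fst p)"
    using g unfolding cond_mean_r_def by auto
  then show ?thesis
    unfolding mu_train_def by (subst AE_distr_iff) auto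
qed

text \<open>\<open>D = m2 * g1 - m1 * g2\<close> has integral 0 and changes sign only once, from negative to positive,
  at some threshold \<open>t\<close>; hence \<open>(h t - h) * D \<ge> 0\<close>.\<close>

lemma monotone_likelihood_ratio_integral_le:
  fixes g1 g2 h :: "real \<Rightarrow> real"
  assumes int: "integrable M g1" "integrable M g2"
      "integrable M (\<lambda>l. h l * g1 l)" "integrable M (\<lambda>l. h l * g2 l)"
    and pos: "0 < (LINT l|M. g2 l)"
    and ae: "AE l in M. l \<in> S \<and> 0 \<le> g2 l" and S: "S \<subseteq> {0..C}" "\<And>l. l \<in> S \<Longrightarrow> g2 l \<noteq> 0"
    and mono: "mono_on S (\<lambda>l. g1 l / g2 l)" and anti: "antimono_on {0..} h"
  shows "(LINT l|M. h l * g1 l) * (LINT l|M. g2 l) \<le> (LINT l|M. h l * g2 l) * (LINT l|M. g1 l)"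
proof -
  define m1 m2 where "m1 = (LINT l|M. g1 l)" and "m2 = (LINT l|M. g2 l)"
  define D where "D l = m2 * g1 l - m1 * g2 l" for l
  \<comment> \<open>Inserting 0 keeps \<open>L\<close> nonempty and its supremum in the domain on
    which \<open>h\<close> is antitone.\<close>
  define L where "L = insert 0 {l\<in>S. g1 l / g2 l < m1 / m2}"
  define t where "t = Sup L"
  have bdd: "bdd_above L"
    using S(1) by (intro bdd_aboveI[of _ "max 0 C"]) (auto simp: L_def)
  then have "0 \<le> t"
    unfolding t_def by (rule cSup_upper[rotated]) (simp add: L_def)
  have D_eq: "D l = m2 * g2 l * (g1 l / g2 l - m1 / m2)" if "g2 l \<noteq> 0" for l
    using that pos by (simp add: D_def m2_def field_simps)
  have sign: "0 \<le> (h t - h l) * D l" if l: "l \<in> S" "0 \<le> g2 l" for l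
  proof -
    have pos_l: "0 < m2 * g2 l" and "0 \<le> l"
      using l S pos by (auto simp: m2_def less_le)
    consider "l < t" | "l = t" | "t < l" by linarith
    then show ?thesis
    proof cases
      case 1
      \<comment> \<open>Because \<open>0 \<le> l\<close> and \<open>l < s\<close>, the point
        \<open>s\<close> is not the inserted 0. Its ratio therefore lies below
        \<open>m1 / m2\<close>, and monotonicity hands this down to \<open>l\<close>.\<close>
      then obtain s where "s \<in> L" "l < s"
        using less_cSup_iff[OF _ bdd, of l] unfolding t_def by (auto simp: L_def)
      then have "s \<in> S" "g1 s / g2 s < m1 / m2"
        using \<open>0 \<le> l\<close> by (auto simp: L_def)
      moreover have "g1 l / g2 l \<le> g1 s / g2 s"
        using mono l \<open>s \<in> S\<close> \<open>l < s\<close> by (auto dest: mono_onD)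
      ultimately have "D l \<le> 0"
        using pos_l l S by (subst D_eq) (auto intro!: mult_nonneg_nonpos)
      moreover have "h t \<le> h l"
        using anti 1 \<open>0 \<le> l\<close> \<open>0 \<le> t\<close> by (auto simp: monotone_on_def)
      ultimately show ?thesis by (intro mult_nonpos_nonpos) auto
    next
      case 3
      then have "l \<notin> L"
        using cSup_upper[OF _ bdd, of l] by (auto simp: t_def)
      then have "0 \<le> D l"
        using pos_l l S by (subst D_eq) (auto simp: L_def intro!: mult_nonneg_nonneg)
      moreover have "h l \<le> h t"
        using anti 3 \<open>0 \<le> l\<close> \<open>0 \<le> t\<close> by (auto simp: monotone_on_def)
      ultimately show ?thesis by (intro mult_nonneg_nonneg) auto
    qed simp
  qed
  \<comment> \<open>The last summand integrates to zero by the choice of \<open>m1\<close> and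
    \<open>m2\<close>.\<close>
  have expand: "(h t - h l) * D l = m1 * (h l * g2 l) - m2 * (h l * g1 l) + h t * (m2 * g1 l - m1 * g2 l)"
    for l by (simp add: D_def algebra_simps)
  have "0 \<le> (LINT l|M. (h t - h l) * D l)"
    using ae sign by (intro integral_nonneg_AE) auto
  also have "\<dots> = m1 * (LINT l|M. h l * g2 l) - m2 * (LINT l|M. h l * g1 l)"
    unfolding expand using int by (simp flip: m1_def m2_def)
  finally show ?thesis
    by (simp add: m1_def m2_def mult.commute)
qed


section \<open>Resolvent functionals and uniqueness of the root\<close>

lemma integrable_resolvent:
  assumes \<mu>: "ljsd \<mu>" and "0 < \<phi>" "0 \<le> x"
  shows "integrable \<mu> (\<lambda>p. fst p / (\<phi> + x * fst p))"
    and "integrable \<mu> (\<lambda>p. snd p / (\<phi> + x * fst p))"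
proof -
  note [measurable] = ljsd_measurable(2,3)[OF \<mu>]
  obtain C where "AE p in \<mu>. fst p \<in> {0..C} \<and> snd p \<in> {0..C}"
    using ljsdE[OF \<mu>] by blast
  then have bound: "AE p in \<mu>. norm (u p / (\<phi> + x * fst p)) \<le> norm (u p / \<phi>)"
    for u :: "real \<times> real \<Rightarrow> real"
  proof (rule AE_mp, intro AE_I2 impI)
    fix p assume "fst p \<in> {0..C} \<and> snd p \<in> {0..C}"
    then have "\<phi> \<le> \<phi> + x * fst p"
      using assms(3) by simp
    then show "norm (u p / (\<phi> + x * fst p)) \<le> norm (u p / \<phi>)"
      using assms(2) by (auto simp: abs_mult intro!: divide_left_mono)
  qed
  show "integrable \<mu> (\<lambda>p. fst p / (\<phi> + x * fst p))"
    by (rule Bochner_Integration.integrable_bound[OF _ _ bound]) (use \<mu> in \<open>auto simp: ljsd_def\<close>)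
  show "integrable \<mu> (\<lambda>p. snd p / (\<phi> + x * fst p))"
    by (rule Bochner_Integration.integrable_bound[OF _ _ bound]) (use \<mu> in \<open>auto simp: ljsd_def\<close>)
qed

lemma Ifun_1_1_nonneg:
  assumes \<mu>: "ljsd \<mu>" and "0 < \<phi>" "0 \<le> x"
  shows "0 \<le> Ifun \<phi> \<mu> 1 1 x"
proof -
  obtain C where "AE p in \<mu>. fst p \<in> {0..C} \<and> snd p \<in> {0..C}"
    using ljsdE[OF \<mu>] by blast
  then have "AE p in \<mu>. 0 \<le> fst p / (\<phi> + x * fst p)"
    by eventually_elim (use assms in auto)
  then show ?thesis
    using assms(2) by (simp add: Ifun_def integral_nonneg_AE)
qed

lemma Istar_1_1_nonneg:
  assumes \<mu>: "ljsd \<mu>" and "0 < \<phi>" "0 \<le> x"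
  shows "0 \<le> Istar \<phi> \<mu> 1 1 x"
proof -
  obtain C where "AE p in \<mu>. fst p \<in> {0..C} \<and> snd p \<in> {0..C}"
    using ljsdE[OF \<mu>] by blast
  then have "AE p in \<mu>. 0 \<le> snd p / (\<phi> + x * fst p)"
    by eventually_elim (use assms in auto)
  then show ?thesis
    using assms(2) by (simp add: Istar_def integral_nonneg_AE)
qed

text \<open>The integrand increases strictly in \<open>x\<close> at every positive eigenvalue. A
  bound \<open>c * l\<close> on the increment, with one \<open>c > 0\<close> for all
  \<open>l\<close>, keeps the inequality strict after integration, since the mean eigenvalue is
  positive.\<close>

lemma mult_Ifun_1_1_strict_mono:
  assumes \<mu>: "ljsd \<mu>" and \<phi>: "0 < \<phi>" and x: "0 \<le> x" "x < y"
  shows "x * Ifun \<phi> \<mu> 1 1 x < y * Ifun \<phi> \<mu> 1 1 y"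
proof -
  obtain C where C: "0 \<le> C" "AE p in \<mu>. fst p \<in> {0..C} \<and> snd p \<in> {0..C}"
    using ljsdE[OF \<mu>] by blast
  \<comment> \<open>The exact increment is \<open>l\<close> times this expression with
    \<open>l\<close> in place of \<open>C\<close>; it is smallest at \<open>l = C\<close>.\<close>
  define c where "c = \<phi> * (y - x) / ((\<phi> + x * C) * (\<phi> + y * C))"
  have denom: "0 < \<phi> + x * C" "0 < \<phi> + y * C"
    using \<phi> x C(1) by (auto intro: add_pos_nonneg)
  then have "0 < c"
    using \<phi> x by (simp add: c_def)
  have le: "c * l \<le> y * (l / (\<phi> + y * l)) - x * (l / (\<phi> + x * l))" if l: "l \<in> {0..C}" for l
  proof -
    have pos: "0 < \<phi> + x * l" "0 < \<phi> + y * l"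
      using \<phi> x l by (auto intro: add_pos_nonneg)
    have "c \<le> \<phi> * (y - x) / ((\<phi> + x * l) * (\<phi> + y * l))"
      unfolding c_def using \<phi> x l C(1) pos denom
      by (intro divide_left_mono mult_mono mult_pos_pos add_left_mono mult_left_mono) auto
    then have "c * l \<le> \<phi> * (y - x) / ((\<phi> + x * l) * (\<phi> + y * l)) * l"
      using l by (intro mult_right_mono) auto
    also have "\<dots> = y * (l / (\<phi> + y * l)) - x * (l / (\<phi> + x * l))"
      using pos by (simp add: divide_simps) (simp add: algebra_simps)
    finally show ?thesis .
  qed
  have int: "integrable \<mu> (\<lambda>p. z * (fst p / (\<phi> + z * fst p)))" if "0 \<le> z" for z
    using integrable_resolvent(1)[OF \<mu> \<phi> that] by (rule integrable_mult_right)
  have "0 < c * (LINT p|\<mu>. fst p)"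
    using \<open>0 < c\<close> \<mu> by (simp add: ljsd_def)
  also have "\<dots> = (LINT p|\<mu>. c * fst p)"
    by simp
  also have "\<dots> \<le> (LINT p|\<mu>. y * (fst p / (\<phi> + y * fst p)) - x * (fst p / (\<phi> + x * fst p)))"
  proof (rule integral_mono_AE)
    show "integrable \<mu> (\<lambda>p. c * fst p)"
      using \<mu> by (simp add: ljsd_def)
    show "integrable \<mu> (\<lambda>p. y * (fst p / (\<phi> + y * fst p)) - x * (fst p / (\<phi> + x * fst p)))"
      using x by (intro Bochner_Integration.integrable_diff int) auto
    show "AE p in \<mu>. c * fst p \<le> y * (fst p / (\<phi> + y * fst p)) - x * (fst p / (\<phi> + x * fst p))"
      using C(2) by eventually_elim (use le in auto)
  qed
  also have "\<dots> = y * (LINT p|\<mu>. fst p / (\<phi> + y * fst p)) - x * (LINT p|\<mu>. fst p / (\<phi> + x * fst p))"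
    using x by (simp only: Bochner_Integration.integral_diff int integral_mult_right_zero)
  finally show ?thesis
    using \<phi> by (simp add: Ifun_def mult.left_commute)
qed

text \<open>Cleared of its denominator, the root equation equates 1 with an expression that is
  strictly increasing in \<open>x\<close> once \<open>omega\<close> is nonnegative.\<close>

lemma is_root_unique:
  assumes \<mu>: "ljsd \<mu>" and \<phi>: "0 < \<phi>" and \<omega>: "0 \<le> omega \<sigma> (mean_lam \<mu>)"
    and roots: "is_root \<phi> \<sigma> \<mu> x" "is_root \<phi> \<sigma> \<mu> y"
  shows "x = y"
proof -
  have root_eq: "x * omega \<sigma> (mean_lam \<mu>) + x * Ifun \<phi> \<mu> 1 1 x = 1" if "is_root \<phi> \<sigma> \<mu> x" for x
  proof -
    define d where "d = omega \<sigma> (mean_lam \<mu>) + Ifun \<phi> \<mu> 1 1 x"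
    have "0 < x" "x = 1 / d"
      using that by (auto simp: is_root_def d_def)
    \<comment> \<open>The case \<open>d = 0\<close> is excluded because division by zero yields 0,
      against \<open>0 < x\<close>.\<close>
    then have "x * d = 1"
      by (cases "d = 0") auto
    then show ?thesis
      by (simp add: d_def distrib_left)
  qed
  have False if "is_root \<phi> \<sigma> \<mu> x" "is_root \<phi> \<sigma> \<mu> y" "x < y" for x y
  proof -
    have "x * Ifun \<phi> \<mu> 1 1 x < y * Ifun \<phi> \<mu> 1 1 y"
      using that by (intro mult_Ifun_1_1_strict_mono[OF \<mu> \<phi>]) (auto simp: is_root_def)
    moreover have "x * omega \<sigma> (mean_lam \<mu>) \<le> y * omega \<sigma> (mean_lam \<mu>)"
      using that(3) \<omega> by (intro mult_right_mono) auto
    ultimately show False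
      using root_eq[OF that(1)] root_eq[OF that(2)] by linarith
  qed
  with roots show ?thesis
    by (metis linorder_neqE_linordered_idom)
qed

section \<open>Comparison of the two distributions\<close>

lemma
  assumes "ljsd \<mu>1" "ljsd \<mu>2" "mu_train \<mu>1 = mu_train \<mu>2"
  shows mean_lam_cong_train: "mean_lam \<mu>1 = mean_lam \<mu>2"
    and Ifun_cong_train: "Ifun \<phi> \<mu>1 a b = Ifun \<phi> \<mu>2 a b"
proof -
  show "mean_lam \<mu>1 = mean_lam \<mu>2"
    using integral_mu_train(2)[OF assms(1), of "\<lambda>l. l"] integral_mu_train(2)[OF assms(2), of "\<lambda>l. l"] assms(3)
    by (simp add: mean_lam_def)
  show "Ifun \<phi> \<mu>1 a b = Ifun \<phi> \<mu>2 a b"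
  proof
    fix x
    have meas: "(\<lambda>l. l ^ a / (\<phi> + x * l) ^ b) \<in> borel_measurable borel"
      by measurable
    show "Ifun \<phi> \<mu>1 a b x = Ifun \<phi> \<mu>2 a b x"
      unfolding Ifun_def integral_mu_train(2)[OF assms(1) meas, symmetric]
        integral_mu_train(2)[OF assms(2) meas, symmetric] assms(3) ..
  qed
qed

text \<open>Each quotient is the \<open>r\<close>-weighted average of the antitone function
  \<open>\<phi> / (\<phi> + x * l)\<close>, so the likelihood ratio inequality applies.\<close>

lemma Istar_1_1_mono_ljsd_le:
  assumes \<mu>: "ljsd \<mu>1" "ljsd \<mu>2" and le: "ljsd_le \<mu>1 \<mu>2" and \<phi>: "0 < \<phi>" and x: "0 \<le> x"
  shows "Istar \<phi> \<mu>1 1 1 x / mean_r \<mu>1 \<le> Istar \<phi> \<mu>2 1 1 x / mean_r \<mu>2"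
proof -
  obtain g1 g2 where g: "cond_mean_r \<mu>1 g1" "cond_mean_r \<mu>2 g2"
    and nz: "\<forall>l\<in>msupport (mu_train \<mu>1). g2 l \<noteq> 0"
    and mono: "mono_on (msupport (mu_train \<mu>1)) (\<lambda>l. g1 l / g2 l)"
    and train: "mu_train \<mu>1 = mu_train \<mu>2"
    using le unfolding ljsd_le_def by blast
  define M where "M = mu_train \<mu>1"
  define h where "h l = 1 / (\<phi> + x * l)" for l
  have [measurable]: "h \<in> borel_measurable borel"
    unfolding h_def by measurable
  \<comment> \<open>The constant weight 1 is included to express \<open>mean_r\<close> through
    \<open>g1\<close> and \<open>g2\<close>.\<close>
  have int: "integrable \<mu> (\<lambda>p. h (fst p) * snd p)" "integrable \<mu> (\<lambda>p. 1 * snd p)" if "ljsd \<mu>" for \<mu>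
    using integrable_resolvent(2)[OF that \<phi> x] that by (simp_all add: h_def ljsd_def)
  note c = cond_mean_r_integral[OF _ _ _ int(1)] cond_mean_r_integral[OF _ _ _ int(2)]
  note c1 = c[OF \<mu>(1) g(1) _ \<mu>(1), folded M_def]
  note c2 = c[OF \<mu>(2) g(2) _ \<mu>(2), folded train M_def]
  have r: "0 < mean_r \<mu>1" "0 < mean_r \<mu>2"
    using \<mu> by (auto simp: ljsd_def mean_r_def)
  obtain C where C: "AE p in \<mu>1. fst p \<in> {0..C} \<and> snd p \<in> {0..C}"
    using ljsdE[OF \<mu>(1)] by blast
  interpret \<mu>1: prob_space \<mu>1
    using \<mu>(1) by (simp add: ljsd_def)
  have "AE p in \<mu>1. fst p \<in> {0..C}"
    using C by auto
  then have "AE l in M. l \<in> {0..C}"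
    unfolding M_def mu_train_def using ljsd_measurable(2)[OF \<mu>(1)] by (subst AE_distr_iff) auto
  moreover have "AE l in M. l \<in> msupport M"
    unfolding M_def mu_train_def
    by (intro AE_msupport \<mu>1.finite_measure_distr ljsd_measurable(2) \<mu>) simp
  moreover have "AE l in M. 0 \<le> g2 l"
    using cond_mean_r_nonneg[OF \<mu>(2) g(2)] unfolding M_def train .
  ultimately have ae: "AE l in M. l \<in> msupport M \<inter> {0..C} \<and> 0 \<le> g2 l"
    by auto
  have "(LINT l|M. h l * g1 l) * (LINT l|M. g2 l) \<le> (LINT l|M. h l * g2 l) * (LINT l|M. g1 l)"
  proof (rule monotone_likelihood_ratio_integral_le[OF _ _ _ _ _ ae])
    show "antimono_on {0..} h"
      using \<phi> x by (auto simp: monotone_on_def h_def intro!: divide_left_mono mult_left_mono add_pos_nonneg mult_pos_pos)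
    show "mono_on (msupport M \<inter> {0..C}) (\<lambda>l. g1 l / g2 l)"
      using mono by (auto simp: M_def intro: mono_on_subset)
    show "0 < (LINT l|M. g2 l)"
      using c2 r by (simp add: mean_r_def)
  qed (use c1 c2 nz in \<open>auto simp: M_def\<close>)
  then have "(LINT p|\<mu>1. h (fst p) * snd p) * mean_r \<mu>2 \<le> (LINT p|\<mu>2. h (fst p) * snd p) * mean_r \<mu>1"
    using c1 c2 by (simp add: mean_r_def)
  then have "\<phi> * ((LINT p|\<mu>1. h (fst p) * snd p) * mean_r \<mu>2)
      \<le> \<phi> * ((LINT p|\<mu>2. h (fst p) * snd p) * mean_r \<mu>1)"
    using \<phi> by (intro mult_left_mono) auto
  then show ?thesis
    using r by (simp add: Istar_def h_def field_simps)
qed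

section \<open>The coefficient of the noise-amplification term\<close>

text \<open>The square root disappears since \<open>rho\<close> is a square; multiplying by
  \<open>rho = zeta / t\<close> turns \<open>omega\<close> into \<open>eta - zeta\<close>.\<close>

lemma xi_square_mult:
  assumes "0 < mean_r \<mu>" "zeta \<sigma> (mean_r \<mu>) \<noteq> 0"
  shows "(xi \<sigma> \<mu>)\<^sup>2 * (omega \<sigma> (mean_r \<mu>) + J)
    = (eta \<sigma> (mean_r \<mu>) - zeta \<sigma> (mean_r \<mu>) * (1 - J / mean_r \<mu>)) / rho \<sigma> (mean_lam \<mu>)"
proof -
  have "(xi \<sigma> \<mu>)\<^sup>2 = rho \<sigma> (mean_r \<mu>) / rho \<sigma> (mean_lam \<mu>)"
    by (simp add: xi_def rho_def)
  moreover have "rho \<sigma> (mean_r \<mu>) * (omega \<sigma> (mean_r \<mu>) + J)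
      = eta \<sigma> (mean_r \<mu>) - zeta \<sigma> (mean_r \<mu>) * (1 - J / mean_r \<mu>)"
    using assms by (simp add: omega_def zeta_def field_simps)
  ultimately show ?thesis
    by simp
qed

text \<open>With \<open>R = \<zeta>2 / \<zeta>1\<close>, the left side is nonnegative, so scaling it
  by \<open>R \<ge> 1\<close> increases it. Scaling turns \<open>\<zeta>1\<close> into
  \<open>\<zeta>2\<close> and \<open>\<eta>1\<close> into at most \<open>\<eta>2\<close>; raising
  \<open>q1\<close> to \<open>q2\<close> then increases it further.\<close>

lemma weighted_gap_mono:
  fixes \<eta>1 :: real
  assumes "0 < \<zeta>1" "\<zeta>1 \<le> \<eta>1" "1 \<le> \<zeta>2 / \<zeta>1" "\<zeta>2 / \<zeta>1 \<le> \<eta>2 / \<eta>1" "0 \<le> q1" "q1 \<le> q2"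
  shows "\<eta>1 - \<zeta>1 * (1 - q1) \<le> \<eta>2 - \<zeta>2 * (1 - q2)"
proof -
  define R where "R = \<zeta>2 / \<zeta>1"
  have R: "1 \<le> R" "\<zeta>2 = R * \<zeta>1" "R * \<eta>1 \<le> \<eta>2"
    using assms by (auto simp: R_def pos_le_divide_eq)
  have "0 \<le> \<zeta>1 * q1"
    using assms by simp
  then have "0 \<le> \<eta>1 - \<zeta>1 * (1 - q1)"
    using assms(2) by (simp add: right_diff_distrib)
  then have "1 * (\<eta>1 - \<zeta>1 * (1 - q1)) \<le> R * (\<eta>1 - \<zeta>1 * (1 - q1))"
    using R by (intro mult_right_mono)
  also have "\<dots> \<le> \<eta>2 - \<zeta>2 * (1 - q1)"
    using R by (simp add: algebra_simps)
  also have "\<dots> \<le> \<eta>2 - \<zeta>2 * (1 - q2)"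
    using assms R by (intro diff_left_mono mult_left_mono) auto
  finally show ?thesis by simp
qed

section \<open>Monotonicity of the generalization gap\<close>

theorem proposition5p5:
  fixes \<phi> \<psi> \<psi>' v :: real
    and \<sigma> :: "real \<Rightarrow> real"
    and \<mu>1 \<mu>2 :: "(real \<times> real) measure"
  assumes "0 < \<phi>" and "0 \<le> v" and "activation \<sigma>"
    and "ljsd \<mu>1" and "ljsd \<mu>2" and "ljsd_le \<mu>1 \<mu>2"
    and "constants_defined \<sigma> (mean_lam \<mu>1)"
    and "constants_defined \<sigma> (mean_r \<mu>1)"
    and "constants_defined \<sigma> (mean_r \<mu>2)"
    and "\<exists>x. is_root \<phi> \<sigma> \<mu>1 x"
    and "1 \<le> zeta \<sigma> (mean_r \<mu>2) / zeta \<sigma> (mean_r \<mu>1)"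
    and "zeta \<sigma> (mean_r \<mu>2) / zeta \<sigma> (mean_r \<mu>1) \<le> eta \<sigma> (mean_r \<mu>2) / eta \<sigma> (mean_r \<mu>1)"
    and "0 < \<psi>" and "\<psi> < \<phi>" and "0 < \<psi>'" and "\<psi>' < \<phi>"
    and "\<phi> / \<psi> \<le> \<phi> / \<psi>'"
  shows "test_error \<phi> \<psi>' v \<sigma> \<mu>2 - test_error \<phi> \<psi>' v \<sigma> \<mu>1
           \<le> test_error \<phi> \<psi> v \<sigma> \<mu>2 - test_error \<phi> \<psi> v \<sigma> \<mu>1"
proof -
  note \<mu> = \<open>ljsd \<mu>1\<close> \<open>ljsd \<mu>2\<close> and \<phi> = \<open>0 < \<phi>\<close>
  have s: "0 < mean_lam \<mu>1" "0 < mean_r \<mu>1" "0 < mean_r \<mu>2"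
    using \<mu> by (auto simp: ljsd_def mean_lam_def mean_r_def)
  note z = zeta_le_eta[OF \<open>activation \<sigma>\<close>]
  have nz: "zeta \<sigma> (mean_lam \<mu>1) \<noteq> 0" "zeta \<sigma> (mean_r \<mu>1) \<noteq> 0" "zeta \<sigma> (mean_r \<mu>2) \<noteq> 0"
    using assms(7-9) by (auto simp: constants_defined_def)
  have train: "mu_train \<mu>1 = mu_train \<mu>2"
    using \<open>ljsd_le \<mu>1 \<mu>2\<close> by (simp add: ljsd_le_def)
  note lam_eq = mean_lam_cong_train[OF \<mu> train] and Ifun_eq = Ifun_cong_train[OF \<mu> train]
  have \<omega>: "0 \<le> omega \<sigma> (mean_lam \<mu>1)"
    using z[OF s(1) nz(1)] s(1) by (simp add: omega_def)
  obtain x where root: "is_root \<phi> \<sigma> \<mu>1 x"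
    using assms(10) by blast
  then have x: "0 < x"
    by (simp add: is_root_def)
  have xroot1: "xroot \<phi> \<sigma> \<mu>1 = x"
    unfolding xroot_def using root is_root_unique[OF \<mu>(1) \<phi> \<omega>] by blast
  moreover have "is_root \<phi> \<sigma> \<mu>2 = is_root \<phi> \<sigma> \<mu>1"
    by (intro ext) (simp add: is_root_def lam_eq Ifun_eq)
  ultimately have xroot2: "xroot \<phi> \<sigma> \<mu>2 = x"
    by (simp add: xroot_def)
  define W where "W = x * (v + Ifun \<phi> \<mu>1 1 1 x)"
  define A where "A \<mu> = (xi \<sigma> \<mu>)\<^sup>2 * (omega \<sigma> (mean_r \<mu>) + Istar \<phi> \<mu> 1 1 x)" for \<mu>
  define T where "T \<psi> = \<psi> / (\<phi> - \<psi>)" for \<psi>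
  \<comment> \<open>The claim is rearranged to compare two values of \<open>\<psi>\<close> at one
    fixed distribution: the bias and the second variance term do not contain \<open>\<psi>\<close>
    and cancel.\<close>
  have error_diff: "test_error \<phi> \<psi> v \<sigma> \<mu> - test_error \<phi> \<psi>' v \<sigma> \<mu> = (T \<psi> - T \<psi>') * W * A \<mu>"
    if "\<mu> = \<mu>1 \<or> \<mu> = \<mu>2" for \<mu>
  proof -
    have "xroot \<phi> \<sigma> \<mu> = x" "W = x * (v + Ifun \<phi> \<mu> 1 1 x)"
      using that xroot1 xroot2 Ifun_eq by (auto simp: W_def)
    moreover have "(B + (X * t * x * a * b + Y)) - (B + (X * t' * x * a * b + Y))
        = (t - t') * (x * a) * (X * b)" for B X Y t t' a b :: real
      by (simp add: algebra_simps)
    ultimately show ?thesis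
      unfolding test_error_def variance_term_def T_def A_def Let_def by presburger
  qed
  have "A \<mu>1 \<le> A \<mu>2"
  proof -
    have "eta \<sigma> (mean_r \<mu>1) - zeta \<sigma> (mean_r \<mu>1) * (1 - Istar \<phi> \<mu>1 1 1 x / mean_r \<mu>1)
        \<le> eta \<sigma> (mean_r \<mu>2) - zeta \<sigma> (mean_r \<mu>2) * (1 - Istar \<phi> \<mu>2 1 1 x / mean_r \<mu>2)"
    proof (rule weighted_gap_mono)
      show "Istar \<phi> \<mu>1 1 1 x / mean_r \<mu>1 \<le> Istar \<phi> \<mu>2 1 1 x / mean_r \<mu>2"
        using \<mu> \<phi> x \<open>ljsd_le \<mu>1 \<mu>2\<close> by (intro Istar_1_1_mono_ljsd_le) auto
      show "0 \<le> Istar \<phi> \<mu>1 1 1 x / mean_r \<mu>1"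
        using Istar_1_1_nonneg[OF \<mu>(1) \<phi>, of x] s x by simp
    qed (use z[OF s(2) nz(2)] assms(11,12) in auto)
    moreover have "0 \<le> rho \<sigma> (mean_lam \<mu>1)"
      by (simp add: rho_def)
    ultimately show ?thesis
      unfolding A_def xi_square_mult[OF s(2) nz(2)] xi_square_mult[OF s(3) nz(3)] lam_eq[symmetric]
      by (rule divide_right_mono)
  qed
  moreover have "0 \<le> W"
    using Ifun_1_1_nonneg[OF \<mu>(1) \<phi>, of x] x \<open>0 \<le> v\<close> by (simp add: W_def)
  \<comment> \<open>A larger ratio \<open>\<phi> / \<psi>\<close> means a smaller
    \<open>\<psi>\<close>, and \<open>T\<close> increases on the interval from 0 to
    \<open>\<phi>\<close>.\<close>
  moreover have "T \<psi>' \<le> T \<psi>"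
  proof -
    have "\<psi>' \<le> \<psi>"
      using assms(13-17) \<phi> by (simp add: field_simps)
    then show ?thesis
      unfolding T_def using assms(13-16) by (intro frac_le) auto
  qed
  ultimately have "(T \<psi> - T \<psi>') * W * A \<mu>1 \<le> (T \<psi> - T \<psi>') * W * A \<mu>2"
    by (intro mult_left_mono mult_nonneg_nonneg) auto
  then show ?thesis
    using error_diff[of \<mu>1] error_diff[of \<mu>2] by simp
qed

end
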